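(* Let $w_1,w_2,d\in\mathbb{N}$ with $d\equiv w_1\equiv w_2\equiv 1\pmod 2$, let $\chi$ be a Dirichlet character with conductor $d$, and let $\lambda\neq0$ be a parameter. Then for every integer $n\ge 0$, \[ w_{2}^{n}\sum_{l=0}^{dw_{2}-1}(-1)^{l}\chi(l)\,\mathcal{E}_{n,\frac{\lambda}{w_{2}},\chi}\!\left(w_{1}x+\frac{w_{1}}{w_{2}}l\right) =w_{1}^{n}\sum_{l=0}^{dw_{1}-1}(-1)^{l}\chi(l)\,\mathcal{E}_{n,\frac{\lambda}{w_{1}},\chi}\!\left(w_{2}x+\frac{w_{2}}{w_{1}}l\right). \]
   Context: For $d\in\mathbb{N}$ odd, a Dirichlet character $\chi$ with conductor $d$, and a nonzero parameter $\mu$, the generalized degenerate Euler polynomials $\mathcal{E}_{n,\mu,\chi}(x)$ attached to $\chi$ are defined by the generating function (formal power series in $t$) \[ \frac{2\sum_{a=0}^{d-1}(-1)^{a}\chi(a)(1+\mu t)^{a/\mu}}{(1+\mu t)^{d/\mu}+1}\,(1+\mu t)^{x/\mu}=\sum_{n=0}^{\infty}\mathcal{E}_{n,\mu,\chi}(x)\frac{t^{n}}{n!}. \] *)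

theory Defs
  imports "HOL-Computational_Algebra.Formal_Power_Series"
begin

(* Values may lie in any field: besides the complex numbers, symmetric identities
   of this kind are also used with p-adic values and with formal parameters. *)
definition dirichlet_character :: "nat \<Rightarrow> (int \<Rightarrow> 'a::field) \<Rightarrow> bool" where
  "dirichlet_character m \<chi> \<longleftrightarrow>
     m > 0 \<and>
     (\<forall>a. \<chi> (a + int m) = \<chi> a) \<and>
     (\<forall>a b. \<chi> (a * b) = \<chi> a * \<chi> b) \<and>
     (\<forall>a. \<chi> a \<noteq> 0 \<longleftrightarrow> coprime a (int m))"

(* The conductor of a character modulo m: the least modulus from which it is induced. *)
definition conductor :: "nat \<Rightarrow> (int \<Rightarrow> 'a::field) \<Rightarrow> nat" where
  "conductor m \<chi> =
     (LEAST f. f dvd m \<and>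
        (\<exists>\<psi>. dirichlet_character f \<psi> \<and> (\<forall>a. coprime a (int m) \<longrightarrow> \<chi> a = \<psi> a)))"

(* A Dirichlet character with conductor d is, as usual, a primitive character modulo d,
   so that it is d-periodic and vanishes exactly off the residues prime to d. *)
definition dirichlet_character_with_conductor :: "nat \<Rightarrow> (int \<Rightarrow> 'a::field) \<Rightarrow> bool" where
  "dirichlet_character_with_conductor d \<chi> \<longleftrightarrow> dirichlet_character d \<chi> \<and> conductor d \<chi> = d"

(* The formal power series (1 + \<mu> t)^(y / \<mu>) in t, for \<mu> \<noteq> 0;
   fps_binomial c is the binomial series (1 + t)^c. *)
definition degenerate_exp :: "'a::field_char_0 \<Rightarrow> 'a \<Rightarrow> 'a fps" where
  "degenerate_exp \<mu> y = fps_binomial (y / \<mu>) oo (fps_const \<mu> * fps_X)"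

definition gen_degenerate_euler_gf ::
    "nat \<Rightarrow> 'a::field_char_0 \<Rightarrow> (int \<Rightarrow> 'a) \<Rightarrow> 'a \<Rightarrow> 'a fps" where
  "gen_degenerate_euler_gf d \<mu> \<chi> x =
     (2 * (\<Sum>a<d. (-1) ^ a * fps_const (\<chi> (int a)) * degenerate_exp \<mu> (of_nat a)))
       / (degenerate_exp \<mu> (of_nat d) + 1)
     * degenerate_exp \<mu> x"

definition gen_degenerate_euler ::
    "nat \<Rightarrow> nat \<Rightarrow> 'a::field_char_0 \<Rightarrow> (int \<Rightarrow> 'a) \<Rightarrow> 'a \<Rightarrow> 'a" where
  "gen_degenerate_euler d n \<mu> \<chi> x = fact n * fps_nth (gen_degenerate_euler_gf d \<mu> \<chi> x) n"

lemma gen_degenerate_euler_gf_eq: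
  "Abs_fps (\<lambda>n. gen_degenerate_euler d n \<mu> \<chi> x / fact n) = gen_degenerate_euler_gf d \<mu> \<chi> x"
  by (rule fps_ext) (simp add: gen_degenerate_euler_def)

lemma degenerate_exp_nth:
  "fps_nth (degenerate_exp \<mu> y) n = ((y / \<mu>) gchoose n) * \<mu> ^ n"
  by (simp add: degenerate_exp_def fps_compose_linear)

(* The denominator has constant term 2, so the division is one by a unit. *)
lemma gen_degenerate_euler_denominator_nth_0:
  "fps_nth (degenerate_exp \<mu> (of_nat d) + 1) 0 = 2"
  by (simp add: degenerate_exp_nth)

end

theory Submission
  imports Defs
begin

text \<open>
  Replacing \<open>t\<close> by \<open>w\<^sub>2 t\<close> turns \<open>(1 + \<lambda> t / w\<^sub>2)\<close>-powers into powers of \<open>1 + \<lambda> t\<close>, so that with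
  \<open>e(y) = (1 + \<lambda> t)\<^bsup>y / \<lambda>\<^esup>\<close> and \<open>S(w) = \<Sum>a<d. (-1)\<^sup>a \<chi>(a) e(w a)\<close> the left-hand side is \<open>n!\<close> times
  the \<open>n\<close>-th coefficient of
  \<open>2 S(w\<^sub>2) / (e(d w\<^sub>2) + 1) * e(w\<^sub>1 w\<^sub>2 x) * (\<Sum>l<d w\<^sub>2. (-1)\<^sup>l \<chi>(l) e(w\<^sub>1 l))\<close>.
  Splitting \<open>l = a + d j\<close>, the last sum is \<open>S(w\<^sub>1)\<close> times a geometric sum equal to
  \<open>(e(d w\<^sub>1 w\<^sub>2) + 1) / (e(d w\<^sub>1) + 1)\<close>, and the product is symmetric in \<open>w\<^sub>1\<close> and \<open>w\<^sub>2\<close>.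
\<close>

lemma degenerate_exp_0 [simp]: "degenerate_exp \<mu> 0 = 1"
  by (simp add: degenerate_exp_def fps_binomial_0)

lemma degenerate_exp_add:
  "degenerate_exp \<mu> (x + y) = degenerate_exp \<mu> x * degenerate_exp \<mu> y"
  by (simp add: degenerate_exp_def add_divide_distrib fps_binomial_add_mult
      fps_compose_mult_distrib)

lemma degenerate_exp_of_nat_mult:
  "degenerate_exp \<mu> (of_nat j * y) = degenerate_exp \<mu> y ^ j"
  by (induction j) (simp_all add: degenerate_exp_add distrib_right)

text \<open>On both sides the \<open>n\<close>-th coefficient is
  \<open>((w * y / \<mu>) gchoose n) * \<mu> ^ n\<close>: the \<open>w ^ n\<close> from the
  substitution cancels the one in \<open>(\<mu> / w) ^ n\<close>.\<close>

lemma degenerate_exp_rescale: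
  assumes "w \<noteq> 0"
  shows "degenerate_exp (\<mu> / w) y oo (fps_const w * fps_X) = degenerate_exp \<mu> (w * y)"
  using assms
  by (intro fps_ext)
     (simp add: fps_compose_linear degenerate_exp_nth power_divide mult.commute [of w y])

text \<open>A geometric sum with ratio \<open>- q\<close>; the sign in its closed form flips because
  \<open>(- q) ^ m = - (q ^ m)\<close> for odd \<open>m\<close>.\<close>

lemma alternating_geometric_sum_odd:
  fixes q :: "'a::comm_ring_1"
  assumes "odd m"
  shows "(q + 1) * (\<Sum>j<m. (-1) ^ j * q ^ j) = q ^ m + 1"
proof -
  have "1 - (- q) ^ m = (1 - (- q)) * (\<Sum>j<m. (- q) ^ j)"
    by (rule one_diff_power_eq)
  moreover have "(- q) ^ j = (-1) ^ j * q ^ j" for j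
    by (rule power_minus)
  ultimately show ?thesis
    using assms by (simp add: add.commute)
qed

lemma sum_lessThan_mult_split:
  fixes f :: "nat \<Rightarrow> 'b::comm_monoid_add"
  shows "(\<Sum>l<d * m. f l) = (\<Sum>j<m. \<Sum>a<d. f (a + d * j))"
proof -
  have "(\<Sum>l<m * d. f l) = (\<Sum>j<m. sum f {j * d..<j * d + d})"
    by (rule sum.nat_group [symmetric])
  also have "\<dots> = (\<Sum>j<m. \<Sum>a<d. f (a + d * j))"
  proof (rule sum.cong [OF refl])
    fix j
    show "sum f {j * d..<j * d + d} = (\<Sum>a<d. f (a + d * j))"
      using sum.shift_bounds_nat_ivl [of f 0 "j * d" d]
      by (simp add: atLeast0LessThan ac_simps)
  qed
  finally show ?thesis by (simp add: mult.commute)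
qed

lemma dirichlet_character_periodic:
  assumes "dirichlet_character m \<chi>"
  shows "\<chi> (int (a + m * j)) = \<chi> (int a)"
proof (induction j)
  case (Suc j)
  have "\<chi> (int (a + m * j) + int m) = \<chi> (int (a + m * j))"
    using assms by (simp add: dirichlet_character_def)
  with Suc show ?case by (simp add: ac_simps)
qed simp

text \<open>The range \<open>m\<close> is left free to cover both \<open>S(y)\<close>, where
  \<open>m = d\<close>, and the outer sum over \<open>l\<close>, where
  \<open>m = d * w\<close>.\<close>

definition twisted_exp_sum :: "nat \<Rightarrow> 'a::field_char_0 \<Rightarrow> (int \<Rightarrow> 'a) \<Rightarrow> 'a \<Rightarrow> 'a fps" where
  "twisted_exp_sum m \<mu> \<chi> y =
     (\<Sum>a<m. (-1) ^ a * fps_const (\<chi> (int a)) * degenerate_exp \<mu> (of_nat a * y))"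

text \<open>Periodicity of \<chi> factors the blocks \<open>l = a + d * j\<close> into a geometric
  sum times the sum over one period. Cross-multiplying avoids quotients of series.\<close>

lemma twisted_exp_sum_mult:
  fixes \<chi> :: "int \<Rightarrow> 'a::field_char_0"
  assumes "dirichlet_character d \<chi>" "odd d" "odd m"
  shows "(degenerate_exp \<mu> (of_nat d * y) + 1) * twisted_exp_sum (d * m) \<mu> \<chi> y
       = (degenerate_exp \<mu> (of_nat (d * m) * y) + 1) * twisted_exp_sum d \<mu> \<chi> y"
proof -
  define q where "q = degenerate_exp \<mu> (of_nat d * y)"
  have exp: "degenerate_exp \<mu> (of_nat (a + d * j) * y) = degenerate_exp \<mu> (of_nat a * y) * q ^ j"
    for a j
  proof -
    have "of_nat (a + d * j) * y = of_nat a * y + of_nat j * (of_nat d * y)"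
      by (simp add: algebra_simps)
    then show ?thesis
      by (simp only: degenerate_exp_add degenerate_exp_of_nat_mult [of \<mu> j] q_def)
  qed
  \<comment> \<open>As \<open>d\<close> is odd, \<open>(-1) ^ (d * j) = (-1) ^ j\<close>, so the
    geometric sum alternates.\<close>
  have sign: "(-1) ^ (a + d * j) = (-1) ^ a * ((-1) ^ j :: 'a fps)" for a j
    using \<open>odd d\<close> by (simp add: power_add power_mult)
  have "twisted_exp_sum (d * m) \<mu> \<chi> y
      = (\<Sum>j<m. \<Sum>a<d. ((-1) ^ j * q ^ j) *
          ((-1) ^ a * fps_const (\<chi> (int a)) * degenerate_exp \<mu> (of_nat a * y)))"
    unfolding twisted_exp_sum_def sum_lessThan_mult_split exp sign
      dirichlet_character_periodic [OF assms(1)]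
    by (simp only: mult_ac)
  also have "\<dots> = (\<Sum>j<m. (-1) ^ j * q ^ j) * twisted_exp_sum d \<mu> \<chi> y"
    by (simp only: twisted_exp_sum_def sum_product)
  finally have "(q + 1) * twisted_exp_sum (d * m) \<mu> \<chi> y
      = (q ^ m + 1) * twisted_exp_sum d \<mu> \<chi> y"
    by (simp only: mult.assoc [symmetric] alternating_geometric_sum_odd [OF \<open>odd m\<close>])
  \<comment> \<open>The case \<open>a = 0\<close>, \<open>j = m\<close> of \<open>exp\<close>
    identifies \<open>q ^ m\<close>.\<close>
  then show ?thesis
    using exp [of 0 m] by (simp add: q_def)
qed

lemma gen_degenerate_euler_gf_rescale:
  fixes \<chi> :: "int \<Rightarrow> 'a::field_char_0"
  assumes "w \<noteq> 0"
  shows "(degenerate_exp \<mu> (of_nat d * w) + 1) *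
           (gen_degenerate_euler_gf d (\<mu> / w) \<chi> y oo (fps_const w * fps_X))
       = 2 * twisted_exp_sum d \<mu> \<chi> w * degenerate_exp \<mu> (w * y)"
proof -
  define D where "D = degenerate_exp (\<mu> / w) (of_nat d) + 1"
  define N where "N = 2 * (\<Sum>a<d. (-1) ^ a * fps_const (\<chi> (int a)) *
    degenerate_exp (\<mu> / w) (of_nat a))"
  \<comment> \<open>Constant term 2 makes \<open>D\<close> a unit, so the division can be
    undone.\<close>
  have "fps_nth D 0 \<noteq> 0"
    unfolding D_def gen_degenerate_euler_denominator_nth_0 by simp
  then have "D * (N / D) = N"
    by (simp add: fps_divide_unit mult.left_commute [of D] inverse_mult_eq_1')
  then have gf: "D * gen_degenerate_euler_gf d (\<mu> / w) \<chi> y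
      = N * degenerate_exp (\<mu> / w) y"
    by (simp add: gen_degenerate_euler_gf_def D_def N_def mult.assoc [symmetric])
  define c where "c = fps_const w * fps_X"
  have c0: "fps_nth c 0 = 0" by (simp add: c_def)
  have rescale: "degenerate_exp (\<mu> / w) z oo c = degenerate_exp \<mu> (w * z)" for z
    unfolding c_def using assms by (rule degenerate_exp_rescale)
  have sign: "(-1) ^ a oo c = (-1) ^ a" for a
    by (cases "even a") (simp_all add: fps_compose_uminus)
  have D: "D oo c = degenerate_exp \<mu> (of_nat d * w) + 1"
    by (simp add: D_def fps_compose_add_distrib rescale mult.commute)
  have N: "N oo c = 2 * twisted_exp_sum d \<mu> \<chi> w"
    by (simp add: N_def twisted_exp_sum_def fps_compose_mult_distrib [OF c0] sign
        fps_compose_sum_distrib rescale mult.commute)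
  have "(D * gen_degenerate_euler_gf d (\<mu> / w) \<chi> y) oo c
      = (N * degenerate_exp (\<mu> / w) y) oo c"
    by (simp only: gf)
  then show ?thesis
    by (simp only: fps_compose_mult_distrib [OF c0] D N rescale) (simp only: c_def)
qed

text \<open>The factor \<open>w ^ n\<close> is what replacing \<open>t\<close> by \<open>w t\<close>
  contributes to the \<open>n\<close>-th coefficient. With both denominators cleared, the right side
  is symmetric in \<open>of_nat w\<close> and \<open>v\<close>.\<close>

lemma gen_degenerate_euler_sum_gf:
  fixes \<chi> :: "int \<Rightarrow> 'a::field_char_0" and \<mu> x v :: 'a
  assumes "dirichlet_character d \<chi>" "odd d" "odd w"
  defines "F \<equiv> Abs_fps (\<lambda>n. of_nat w ^ n *
      (\<Sum>l<d * w. (-1) ^ l * \<chi> (int l) *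
         gen_degenerate_euler d n (\<mu> / of_nat w) \<chi> (v * x + v / of_nat w * of_nat l)) / fact n)"
  shows "(degenerate_exp \<mu> (of_nat d * of_nat w) + 1) * (degenerate_exp \<mu> (of_nat d * v) + 1) * F
       = 2 * twisted_exp_sum d \<mu> \<chi> (of_nat w) * twisted_exp_sum d \<mu> \<chi> v *
           (degenerate_exp \<mu> (of_nat (d * w) * v) + 1) * degenerate_exp \<mu> (of_nat w * v * x)"
proof -
  let ?D = "degenerate_exp \<mu> (of_nat d * of_nat w) + 1"
  let ?G = "\<lambda>l. gen_degenerate_euler_gf d (\<mu> / of_nat w) \<chi> (v * x + v / of_nat w * of_nat l)
    oo (fps_const (of_nat w) * fps_X)"
  have w: "(of_nat w :: 'a) \<noteq> 0"
    using \<open>odd w\<close> by (auto elim: oddE)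
  have F: "F = (\<Sum>l<d * w. fps_const ((-1) ^ l * \<chi> (int l)) * ?G l)"
    by (rule fps_ext)
       (simp add: F_def fps_sum_nth fps_compose_linear gen_degenerate_euler_def
         sum_distrib_left sum_divide_distrib mult.left_commute [of "of_nat w ^ _"] mult.assoc)
  \<comment> \<open>Rescaling clears the fraction \<open>v / w\<close>, so the exponential splits
    into a factor free of \<open>l\<close> and
    \<open>degenerate_exp \<mu> (of_nat l * v)\<close>.\<close>
  have arg: "of_nat w * (v * x + v / of_nat w * of_nat l) = of_nat w * v * x + of_nat l * v"
    for l
    using w by (simp add: algebra_simps)
  have const: "fps_const ((-1) ^ l * \<chi> (int l)) = (-1) ^ l * fps_const (\<chi> (int l))" for l
    by (simp flip: fps_const_neg fps_const_power fps_const_mult)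
  have "?D * F = (\<Sum>l<d * w. fps_const ((-1) ^ l * \<chi> (int l)) * (?D * ?G l))"
    unfolding F sum_distrib_left by (simp only: mult_ac)
  also have "\<dots> = (2 * twisted_exp_sum d \<mu> \<chi> (of_nat w) * degenerate_exp \<mu> (of_nat w * v * x)) *
      twisted_exp_sum (d * w) \<mu> \<chi> v"
    unfolding gen_degenerate_euler_gf_rescale [OF w] arg degenerate_exp_add const
      twisted_exp_sum_def [of "d * w"] sum_distrib_left
    by (simp only: mult_ac)
  finally have DF: "?D * F = \<dots>" .
  have "?D * (degenerate_exp \<mu> (of_nat d * v) + 1) * F
      = (degenerate_exp \<mu> (of_nat d * v) + 1) * (?D * F)"
    by (simp only: mult_ac)
  also have "\<dots> = (2 * twisted_exp_sum d \<mu> \<chi> (of_nat w) * degenerate_exp \<mu> (of_nat w * v * x)) *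
      ((degenerate_exp \<mu> (of_nat d * v) + 1) * twisted_exp_sum (d * w) \<mu> \<chi> v)"
    unfolding DF by (simp only: mult_ac)
  finally show ?thesis
    unfolding twisted_exp_sum_mult [OF assms(1-3)] by (simp only: mult_ac)
qed

theorem theorem2:
  fixes w1 w2 d n :: nat
    and \<chi> :: "int \<Rightarrow> 'a::field_char_0"
    and lam x :: 'a
  assumes "odd d" and "odd w1" and "odd w2"
    and "dirichlet_character_with_conductor d \<chi>"
    and "lam \<noteq> 0"
  shows "of_nat w2 ^ n *
           (\<Sum>l<d * w2. (-1) ^ l * \<chi> (int l) *
              gen_degenerate_euler d n (lam / of_nat w2) \<chi>
                (of_nat w1 * x + of_nat w1 / of_nat w2 * of_nat l))
       = of_nat w1 ^ n *
           (\<Sum>l<d * w1. (-1) ^ l * \<chi> (int l) *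
              gen_degenerate_euler d n (lam / of_nat w1) \<chi>
                (of_nat w2 * x + of_nat w2 / of_nat w1 * of_nat l))"
proof -
  have \<chi>: "dirichlet_character d \<chi>"
    using assms(4) by (simp add: dirichlet_character_with_conductor_def)
  define F where "F v w = Abs_fps (\<lambda>n. of_nat w ^ n *
      (\<Sum>l<d * w. (-1) ^ l * \<chi> (int l) *
         gen_degenerate_euler d n (lam / of_nat w) \<chi>
           (of_nat v * x + of_nat v / of_nat w * of_nat l)) / fact n)" for v w :: nat
  define D where "D w = degenerate_exp lam (of_nat d * of_nat w) + 1" for w :: nat
  \<comment> \<open>Power series over a field form an integral domain, so nonzero factors can be
    cancelled below.\<close>
  have D_nz: "D w \<noteq> 0" for w
  proof
    assume "D w = 0"
    then have "fps_nth (D w) 0 = 0" by simp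
    then show False by (simp add: D_def degenerate_exp_nth)
  qed
  have "D w2 * D w1 * F w1 w2 = D w1 * D w2 * F w2 w1"
    unfolding D_def F_def
      gen_degenerate_euler_sum_gf [OF \<chi> \<open>odd d\<close> \<open>odd w1\<close>]
      gen_degenerate_euler_sum_gf [OF \<chi> \<open>odd d\<close> \<open>odd w2\<close>]
    by (simp only: of_nat_mult mult_ac)
  then have "F w1 w2 = F w2 w1"
    using D_nz [of w1] D_nz [of w2] by (simp add: mult.commute [of "D w2"])
  then have "fps_nth (F w1 w2) n = fps_nth (F w2 w1) n"
    by simp
  then show ?thesis
    by (simp add: F_def)
qed

end
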